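(* Consider the problem (P) of minimizing $\tfrac12 x^THx+c^Tx+f_0(y)$ over $(x,y)\in\mathbb{R}^n\times\mathbb{R}^m$ subject to $x^Tx+f_1(y)\le 0$ and $f_j(y)\le 0$ for $j=2,\dots,k$, where $H=H^T\in\mathbb{R}^{n\times n}$ is not positive semidefinite, $c\in\mathbb{R}^n$, $k\ge 1$, and $f_0,f_1,\dots,f_k:\mathbb{R}^m\to\mathbb{R}$ are convex and twice continuously differentiable. Assume that $(x_*,y_* )\in\mathbb{R}^n\times\mathbb{R}^m$ is a global minimizer of (P) and that there exists $\bar y\in\mathbb{R}^m$ such that $f_j(\bar y)<0$ for all $j=1,\dots,k$. Then there exist $\mu^*_j\ge 0$, $j=1,\dots,k$, such that $$(H+\mu_1^*I)x_*+c=0,$$ $$\nabla f_0(y_* )+\tfrac{\mu_1^*}{2}\nabla f_1(y_* )+\sum_{j=2}^k\mu_j^*\nabla f_j(y_* )=0,$$ $$x_*^Tx_*+f_1(y_* )=0,\qquad \mu_j^*f_j(y_* )=0\ \ (j=2,\dots,k),$$ $$H+\mu_1^*I\succeq 0.$$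
   Context: $I$ is the $n\times n$ identity matrix, and $P\succeq 0$ means that the symmetric matrix $P$ is positive semidefinite. *)

theory Defs
  imports "HOL-Analysis.Analysis"
begin

definition pos_semidef :: "real ^ 'n ^ 'n \<Rightarrow> bool" where
  "pos_semidef P \<longleftrightarrow> transpose P = P \<and> (\<forall>v. 0 \<le> v \<bullet> (P *v v))"

(* Meaningful only at points where f is differentiable; see gradient_eq. *)
definition gradient :: "('a::real_inner \<Rightarrow> real) \<Rightarrow> 'a \<Rightarrow> 'a" where
  "gradient f x = (THE D. GDERIV f x :> D)"

lemma gradient_eq:
  assumes "GDERIV f x :> D"
  shows "gradient f x = D"
  unfolding gradient_def
proof (rule the_equality[where P = "\<lambda>D. GDERIV f x :> D", OF assms])
  fix E assume "GDERIV f x :> E"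
  then have "(\<lambda>h. h \<bullet> E) = (\<lambda>h. h \<bullet> D)"
    using assms unfolding gderiv_def by (rule has_derivative_unique)
  then have "\<forall>h. h \<bullet> E = h \<bullet> D"
    by (intro allI) (rule fun_cong)
  then show "E = D"
    by (simp only: vector_eq_rdot vector_eq_ldot)
qed

(* The witness Hess is the Hessian matrix, i.e. the Jacobian of the gradient. *)
definition twice_continuously_differentiable :: "(real ^ 'm \<Rightarrow> real) \<Rightarrow> bool" where
  "twice_continuously_differentiable f \<longleftrightarrow>
     (\<exists>Hess :: real ^ 'm \<Rightarrow> real ^ 'm ^ 'm.
        (\<forall>x. f differentiable (at x)) \<and>
        (\<forall>x. (gradient f has_derivative (\<lambda>v. Hess x *v v)) (at x)) \<and>
        continuous_on UNIV Hess)"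

definition objective ::
    "real ^ 'n ^ 'n \<Rightarrow> real ^ 'n \<Rightarrow> (nat \<Rightarrow> real ^ 'm \<Rightarrow> real) \<Rightarrow> (real ^ 'n) \<times> (real ^ 'm) \<Rightarrow> real" where
  "objective H c f = (\<lambda>(x, y). 1/2 * (x \<bullet> (H *v x)) + c \<bullet> x + f 0 y)"

definition feasible ::
    "nat \<Rightarrow> (nat \<Rightarrow> real ^ 'm \<Rightarrow> real) \<Rightarrow> (real ^ 'n) \<times> (real ^ 'm) \<Rightarrow> bool" where
  "feasible k f = (\<lambda>(x, y). x \<bullet> x + f 1 y \<le> 0 \<and> (\<forall>j\<in>{2..k}. f j y \<le> 0))"

end

theory Submission
  imports Defs
begin

text \<open>
  Write q for the quadratic part of the objective. The set of pairs (a, b) dominating some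
  (x \<bullet> x, q x) is convex although q is not: starting from a convex combination z
  of two points, move along an eigenvector e for the least eigenvalue until x \<bullet> x reaches
  the averaged value; one of the two directions \<open>\<plusminus>e\<close> does not increase the linear part of q,
  and then q lies below its averaged value. In the variables (a, b, y) the problem is therefore
  convex with a Slater point and has Lagrange multipliers. Since (x \<bullet> x, q x, y) is
  always admissible, the minimizer minimizes the Lagrangian over all (x, y), which yields
  stationarity and semidefiniteness; as H is not semidefinite, the first multiplier is positive and
  its constraint is active.
\<close>

section \<open>Lagrange multipliers for convex constraints with a Slater point\<close>

text \<open>A point with \<open>g x < 0\<close> bounds an admissible multiplier above by
  \<open>F x / (- g x)\<close>, one with \<open>g x > 0\<close> bounds it below by
  \<open>- F x / g x\<close>. Convexity puts every lower bound below every upper bound, so the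
  infimum of the upper bounds works; the Slater point \<open>p\<close> makes it an infimum over a
  nonempty set.\<close>

lemma convex_lagrange_multiplier:
  fixes F g :: "'a::real_vector \<Rightarrow> real"
  assumes F: "convex_on C F" and g: "convex_on C g"
    and p: "p \<in> C" "g p < 0"
    and nonneg: "\<And>x. x \<in> C \<Longrightarrow> g x \<le> 0 \<Longrightarrow> 0 \<le> F x"
  shows "\<exists>\<mu>\<ge>0. \<forall>x\<in>C. 0 \<le> F x + \<mu> * g x"
proof -
  define R where "R = {F z / (- g z) | z. z \<in> C \<and> g z < 0}"
  have R_ne: "R \<noteq> {}"
    using p unfolding R_def by blast
  have R_nonneg: "0 \<le> r" if "r \<in> R" for r
  proof -
    obtain z where "z \<in> C" "g z < 0" "r = F z / (- g z)"
      using \<open>r \<in> R\<close> unfolding R_def by blast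
    then show ?thesis
      using nonneg[of z] by (simp add: divide_nonneg_neg divide_nonneg_nonneg)
  qed
  have bdd: "bdd_below R"
    using R_nonneg by (rule bdd_belowI)
  have cross: "- F x / g x \<le> F z / (- g z)"
    if x: "x \<in> C" "g x > 0" and z: "z \<in> C" "g z < 0" for x z
  proof -
    \<comment> \<open>The weight for which \<open>(1 - u) * g x + u * g z = 0\<close>, so that
      convexity forces \<open>g w \<le> 0\<close> at the point \<open>w\<close> of the
      segment.\<close>
    define u where "u = g x / (g x - g z)"
    have u: "0 \<le> u" "0 \<le> 1 - u" "1 - u = - g z / (g x - g z)"
      using x z unfolding u_def by (auto simp: field_simps)
    define w where "w = (1 - u) *\<^sub>R x + u *\<^sub>R z"
    have wC: "w \<in> C"
      using convexD[of C x z "1 - u" u] F x z u(1,2) unfolding w_def convex_on_def by simp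
    have "g w \<le> (1 - u) * g x + u * g z"
      unfolding w_def using x z u(1,2) by (intro convex_onD[OF g]) auto
    also have "\<dots> = 0"
      unfolding u(3) using x z by (simp add: u_def field_simps)
    finally have "0 \<le> F w"
      using nonneg wC by blast
    also have "F w \<le> (1 - u) * F x + u * F z"
      unfolding w_def using x z u(1,2) by (intro convex_onD[OF F]) auto
    also have "\<dots> = (g x * F z - g z * F x) / (g x - g z)"
      unfolding u(3) by (simp add: u_def field_simps diff_divide_distrib)
    finally have "0 \<le> g x * F z - g z * F x"
      using x z by (simp add: zero_le_divide_iff)
    then show ?thesis
      using x z by (simp add: field_simps)
  qed
  have "0 \<le> F x + Inf R * g x" if x: "x \<in> C" for x
  proof (cases "g x" "0::real" rule: linorder_cases)
    case less
    then have "Inf R \<le> F x / (- g x)"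
      using x bdd unfolding R_def by (intro cInf_lower) auto
    then show ?thesis
      using less by (simp add: field_simps)
  next
    case equal
    then show ?thesis using nonneg x by simp
  next
    case greater
    then have "- F x / g x \<le> Inf R"
      using R_ne cross[OF x greater] by (intro cInf_greatest) (auto simp: R_def)
    then show ?thesis
      using greater by (simp add: field_simps)
  qed
  moreover have "0 \<le> Inf R"
    using R_ne R_nonneg by (intro cInf_greatest)
  ultimately show ?thesis by blast
qed

text \<open>Constraint \<open>i\<close> is priced first, on the convex set \<open>D\<close> cut out
  by the remaining constraints. The sum \<open>F + m * g i\<close> is then nonnegative on
  \<open>D\<close> and serves as the new objective in the induction hypothesis, which is why
  \<open>F\<close> is kept arbitrary.\<close>

lemma convex_lagrange_multipliers:
  fixes F :: "'a::real_vector \<Rightarrow> real" and g :: "'i \<Rightarrow> 'a \<Rightarrow> real"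
  assumes "finite J" "convex_on C F" "\<And>j. j \<in> J \<Longrightarrow> convex_on C (g j)"
    and "p \<in> C" "\<And>j. j \<in> J \<Longrightarrow> g j p < 0"
    and "\<And>x. x \<in> C \<Longrightarrow> \<forall>j\<in>J. g j x \<le> 0 \<Longrightarrow> 0 \<le> F x"
  shows "\<exists>\<mu>. (\<forall>j\<in>J. 0 \<le> \<mu> j) \<and> (\<forall>x\<in>C. 0 \<le> F x + (\<Sum>j\<in>J. \<mu> j * g j x))"
  using assms
proof (induction J arbitrary: F rule: finite_induct)
  case empty
  then show ?case by simp
next
  case (insert i J)
  define D where "D = {x \<in> C. \<forall>j\<in>J. g j x \<le> 0}"
  have C: "convex C"
    using insert.prems(1) unfolding convex_on_def by blast
  have D: "convex D"
  proof (rule convexI)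
    fix x y u v
    assume xy: "x \<in> D" "y \<in> D" and uv: "0 \<le> u" "0 \<le> v" "u + v = (1::real)"
    have "g j (u *\<^sub>R x + v *\<^sub>R y) \<le> 0" if "j \<in> J" for j
    proof -
      have "g j (u *\<^sub>R x + v *\<^sub>R y) \<le> u * g j x + v * g j y"
        using insert.prems(2) that xy uv unfolding convex_on_def D_def by auto
      also have "\<dots> \<le> 0"
        using xy uv that unfolding D_def by (auto intro: add_nonpos_nonpos mult_nonneg_nonpos)
      finally show ?thesis .
    qed
    then show "u *\<^sub>R x + v *\<^sub>R y \<in> D"
      using convexD[OF C] xy uv unfolding D_def by auto
  qed
  have "\<exists>m\<ge>0. \<forall>x\<in>D. 0 \<le> F x + m * g i x"
  proof (rule convex_lagrange_multiplier)
    show "convex_on D F" "convex_on D (g i)"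
      using insert.prems(1,2) D unfolding D_def by (auto intro: convex_on_subset)
    show "p \<in> D" "g i p < 0"
      using insert.prems(3,4) unfolding D_def by (auto intro: less_imp_le)
    show "0 \<le> F x" if "x \<in> D" "g i x \<le> 0" for x
      using insert.prems(5) that unfolding D_def by auto
  qed
  then obtain m where m: "m \<ge> 0" "\<And>x. x \<in> D \<Longrightarrow> 0 \<le> F x + m * g i x"
    by blast
  have "\<exists>\<mu>. (\<forall>j\<in>J. 0 \<le> \<mu> j) \<and>
      (\<forall>x\<in>C. 0 \<le> (F x + m * g i x) + (\<Sum>j\<in>J. \<mu> j * g j x))"
  proof (rule insert.IH)
    show "convex_on C (\<lambda>x. F x + m * g i x)"
      using insert.prems(1,2) m(1) by (intro convex_on_add convex_on_cmul) auto
  qed (use insert.prems m(2) in \<open>auto simp: D_def\<close>)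
  then obtain \<mu> where \<mu>: "\<forall>j\<in>J. 0 \<le> \<mu> j"
      "\<forall>x\<in>C. 0 \<le> (F x + m * g i x) + (\<Sum>j\<in>J. \<mu> j * g j x)"
    by blast
  have "(\<Sum>j\<in>J. (\<mu>(i := m)) j * g j x) = (\<Sum>j\<in>J. \<mu> j * g j x)" for x
    using insert.hyps by (intro sum.cong) auto
  then show ?case
    using \<mu> m(1) insert.hyps by (intro exI[of _ "\<mu>(i := m)"]) (auto simp: add.assoc)
qed

section \<open>Minimizers of quadratic functions and the least eigenvector\<close>

lemma linear_plus_square_nonneg:
  fixes p r :: real
  assumes nonneg: "\<And>t. 0 \<le> t * p + t\<^sup>2 * r"
  shows "p = 0 \<and> 0 \<le> r"
proof -
  have r: "0 \<le> r"
    using nonneg[of 1] nonneg[of "-1"] by simp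
  \<comment> \<open>Adding 1 to \<open>r\<close> avoids division by zero when \<open>r = 0\<close>;
    the polynomial still takes the nonpositive value \<open>- q\<^sup>2\<close> at
    \<open>t = - q\<close>.\<close>
  define q where "q = p / (r + 1)"
  have p: "p = q * (r + 1)"
    using r unfolding q_def by simp
  have "0 \<le> (- q) * p + (- q)\<^sup>2 * r"
    by (rule nonneg)
  also have "\<dots> = - q\<^sup>2"
    unfolding p by (simp add: power2_eq_square algebra_simps)
  finally have "q = 0"
    by simp
  with p r show ?thesis by simp
qed

lemma inner_matrix_vector_symmetric:
  fixes A :: "real ^ 'n ^ 'n"
  assumes "transpose A = A"
  shows "x \<bullet> (A *v y) = y \<bullet> (A *v x)"
  by (metis assms dot_lmul_matrix inner_commute transpose_matrix_vector)

definition quadratic :: "real ^ 'n ^ 'n \<Rightarrow> real ^ 'n \<Rightarrow> real ^ 'n \<Rightarrow> real" where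
  "quadratic A b x = 1/2 * (x \<bullet> (A *v x)) + b \<bullet> x"

text \<open>The exact second-order Taylor expansion along a line; \<open>A *v x + b\<close> is the
  gradient, and symmetry merges the two cross terms.\<close>

lemma quadratic_translate:
  assumes "transpose A = A"
  shows "quadratic A b (x + t *\<^sub>R v) =
    quadratic A b x + t * (v \<bullet> (A *v x + b)) + t\<^sup>2 * (v \<bullet> (A *v v) / 2)"
  using inner_matrix_vector_symmetric[OF assms, of x v]
  by (simp add: quadratic_def matrix_vector_right_distrib matrix_vector_mult_scaleR
      inner_simps inner_commute[of b v] power2_eq_square field_simps)

text \<open>On each line through \<open>x0\<close> the increment is a nonnegative polynomial
  \<open>t * p + t\<^sup>2 * r\<close>, which controls both coefficients. Stationarity follows by
  taking the gradient itself as direction.\<close>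

lemma quadratic_minimizer:
  assumes sym: "transpose A = A" and min: "\<And>x. quadratic A b x0 \<le> quadratic A b x"
  shows "A *v x0 + b = 0" "pos_semidef A"
proof -
  have *: "v \<bullet> (A *v x0 + b) = 0 \<and> 0 \<le> v \<bullet> (A *v v) / 2" for v
  proof (rule linear_plus_square_nonneg)
    fix t
    show "0 \<le> t * (v \<bullet> (A *v x0 + b)) + t\<^sup>2 * (v \<bullet> (A *v v) / 2)"
      using min[of "x0 + t *\<^sub>R v"] unfolding quadratic_translate[OF sym] by simp
  qed
  show "A *v x0 + b = 0"
    using *[of "A *v x0 + b"] by simp
  show "pos_semidef A"
    unfolding pos_semidef_def using sym * by auto
qed

lemma shifted_matrix_vector:
  "(H + m *\<^sub>R mat 1) *v x = H *v x + m *\<^sub>R (x :: real ^ 'n)"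
  by (simp add: matrix_vector_mult_add_rdistrib scaleR_matrix_vector_assoc[symmetric])

text \<open>A multiple of \<open>x \<bullet> x\<close> can be absorbed into the matrix, so the
  Lagrangian in \<open>x\<close> is again of the form \<open>quadratic\<close>.\<close>

lemma quadratic_shift:
  "quadratic (H + m *\<^sub>R mat 1) b x = quadratic H b x + m / 2 * (x \<bullet> x)"
  by (simp add: quadratic_def shifted_matrix_vector inner_simps field_simps)

lemma transpose_shift:
  fixes H :: "real ^ 'n ^ 'n"
  assumes "transpose H = H"
  shows "transpose (H + m *\<^sub>R mat 1) = H + m *\<^sub>R mat 1"
  using assms by (simp add: transpose_def vec_eq_iff mat_def)

text \<open>The Rayleigh quotient attains its minimum \<open>\<sigma>\<close> on the compact unit
  sphere, and homogeneity extends the bound to all vectors.\<close>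

lemma least_eigenvector:
  fixes H :: "real ^ 'n ^ 'n"
  assumes sym: "transpose H = H"
  obtains e \<sigma> where "e \<bullet> e = 1" "H *v e = \<sigma> *\<^sub>R e" "\<And>v. \<sigma> * (v \<bullet> v) \<le> v \<bullet> (H *v v)"
proof -
  have "compact (sphere (0::real^'n) 1)" "sphere (0::real^'n) 1 \<noteq> {}"
    by auto
  moreover have "continuous_on (sphere (0::real^'n) 1) (\<lambda>v. v \<bullet> (H *v v))"
    by (intro continuous_intros)
  ultimately obtain e where e: "norm e = 1"
    and min: "\<And>v. norm v = 1 \<Longrightarrow> e \<bullet> (H *v e) \<le> v \<bullet> (H *v v)"
    using continuous_attains_inf[of "sphere (0::real^'n) 1" "\<lambda>v. v \<bullet> (H *v v)"] by auto
  define \<sigma> where "\<sigma> = e \<bullet> (H *v e)"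
  have ee: "e \<bullet> e = 1"
    using e by (simp add: norm_eq_1)
  have le: "\<sigma> * (v \<bullet> v) \<le> v \<bullet> (H *v v)" for v
  proof (cases "v = 0")
    case False
    have "\<sigma> \<le> (v /\<^sub>R norm v) \<bullet> (H *v (v /\<^sub>R norm v))"
      unfolding \<sigma>_def using False by (intro min) simp
    also have "\<dots> = v \<bullet> (H *v v) / (v \<bullet> v)"
      by (simp add: matrix_vector_mult_scaleR dot_square_norm power2_eq_square field_simps)
    finally show ?thesis
      using False by (simp add: field_simps)
  qed simp
  \<comment> \<open>The form of the shifted matrix is nonnegative and vanishes at \<open>e\<close>,
    so \<open>e\<close> is a global minimizer; stationarity there is the eigenvector
    equation.\<close>
  have "(H + (- \<sigma>) *\<^sub>R mat 1) *v e + 0 = 0"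
  proof (rule quadratic_minimizer)
    show "transpose (H + (- \<sigma>) *\<^sub>R mat 1) = H + (- \<sigma>) *\<^sub>R mat 1"
      by (rule transpose_shift[OF sym])
    show "quadratic (H + (- \<sigma>) *\<^sub>R mat 1) 0 e \<le> quadratic (H + (- \<sigma>) *\<^sub>R mat 1) 0 x" for x
      unfolding quadratic_shift using le[of x] ee by (simp add: quadratic_def \<sigma>_def)
  qed
  then have "H *v e = \<sigma> *\<^sub>R e"
    unfolding shifted_matrix_vector by simp
  with ee le that show ?thesis by blast
qed

section \<open>Convexity of the set of dominated pairs\<close>

text \<open>The two roots in \<open>s\<close> have product \<open>- r \<le> 0\<close>, so they lie
  on opposite sides of zero and one of them has the sign that \<open>d\<close> demands.\<close>

lemma square_linear_root:
  fixes p r d :: real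
  assumes "0 \<le> r"
  obtains s where "s\<^sup>2 + 2 * s * p = r" "s * d \<le> 0"
proof -
  define w where "w = sqrt (p\<^sup>2 + r)"
  have w2: "w\<^sup>2 = p\<^sup>2 + r"
    using assms unfolding w_def by simp
  have "\<bar>p\<bar> \<le> w"
    unfolding w_def using assms by (intro real_le_rsqrt) simp
  then have "0 \<le> w - p" "- w - p \<le> 0"
    by linarith+
  moreover have "(w - p)\<^sup>2 + 2 * (w - p) * p = r" "(- w - p)\<^sup>2 + 2 * (- w - p) * p = r"
    using w2 by (simp_all add: power2_eq_square algebra_simps)
  ultimately show thesis
    using that[of "w - p"] that[of "- w - p"]
    by (cases "0 \<le> d") (auto simp: mult_nonneg_nonpos mult_nonpos_nonneg)
qed

text \<open>Expanding from \<open>y\<close> in the direction \<open>x - y\<close> at the parameters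
  1 and \<open>u\<close> leaves the coefficient \<open>u - u\<^sup>2 = u * v\<close> on the
  second-order term.\<close>

lemma quadratic_convex_defect:
  fixes A :: "real ^ 'n ^ 'n"
  assumes sym: "transpose A = A" and uv: "u + v = 1"
  shows "u * quadratic A b x + v * quadratic A b y =
    quadratic A b (u *\<^sub>R x + v *\<^sub>R y) + u * v / 2 * ((x - y) \<bullet> (A *v (x - y)))"
proof -
  have v: "v = 1 - u"
    using uv by simp
  have z: "u *\<^sub>R x + v *\<^sub>R y = y + u *\<^sub>R (x - y)"
    unfolding v by (simp add: algebra_simps)
  define P R where "P = (x - y) \<bullet> (A *v y + b)" and "R = (x - y) \<bullet> (A *v (x - y))"
  have "quadratic A b x = quadratic A b y + P + R / 2"
    using quadratic_translate[OF sym, of b y 1 "x - y"] unfolding P_def R_def by simp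
  moreover have "quadratic A b (y + u *\<^sub>R (x - y)) = quadratic A b y + u * P + u\<^sup>2 * (R / 2)"
    using quadratic_translate[OF sym, of b y u "x - y"] unfolding P_def R_def .
  ultimately show ?thesis
    unfolding z v R_def[symmetric] by (simp add: power2_eq_square field_simps)
qed

lemma square_norm_convex_defect:
  fixes x y :: "'a::real_inner"
  assumes uv: "u + v = 1"
  shows "u * (x \<bullet> x) + v * (y \<bullet> y) =
    (u *\<^sub>R x + v *\<^sub>R y) \<bullet> (u *\<^sub>R x + v *\<^sub>R y) + u * v * ((x - y) \<bullet> (x - y))"
proof -
  have v: "v = 1 - u"
    using uv by simp
  show ?thesis
    unfolding v by (simp add: inner_simps inner_commute[of y x] algebra_simps)
qed

text \<open>The upward closure of the joint range of the two quadratics, which itself is in general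
  not convex (a curve when n = 1). Enlarging is harmless because \<open>a\<close> enters an
  upper-bound constraint and \<open>b\<close> is minimized.\<close>

definition dominated_pairs :: "real ^ 'n ^ 'n \<Rightarrow> real ^ 'n \<Rightarrow> (real \<times> real) set" where
  "dominated_pairs H c = {(a, b). \<exists>x. x \<bullet> x \<le> a \<and> quadratic H c x \<le> b}"

lemma convex_dominated_pairs:
  fixes H :: "real ^ 'n ^ 'n"
  assumes sym: "transpose H = H"
  shows "convex (dominated_pairs H c)"
proof (rule convexI)
  fix p p' u v
  assume pp': "p \<in> dominated_pairs H c" "p' \<in> dominated_pairs H c"
    and uv: "0 \<le> u" "0 \<le> v" "u + v = (1::real)"
  obtain a b a' b' where p: "p = (a, b)" "p' = (a', b')"
    by (metis prod.exhaust)
  obtain x y where x: "x \<bullet> x \<le> a" "quadratic H c x \<le> b"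
    and y: "y \<bullet> y \<le> a'" "quadratic H c y \<le> b'"
    using pp' unfolding p dominated_pairs_def by auto
  obtain e \<sigma> where e: "e \<bullet> e = 1" "H *v e = \<sigma> *\<^sub>R e"
    and \<sigma>: "\<And>v. \<sigma> * (v \<bullet> v) \<le> v \<bullet> (H *v v)"
    using least_eigenvector[OF sym] by blast
  define z where "z = u *\<^sub>R x + v *\<^sub>R y"
  \<comment> \<open>The amount by which \<open>z \<bullet> z\<close> falls short of the averaged
    squared norm; \<open>s\<close> is chosen so that moving by \<open>s *\<^sub>R e\<close> makes up
    exactly this amount.\<close>
  define r where "r = u * v * ((x - y) \<bullet> (x - y))"
  have "0 \<le> r"
    unfolding r_def using uv by simp
  then obtain s where s: "s\<^sup>2 + 2 * s * (e \<bullet> z) = r" "s * (e \<bullet> c) \<le> 0"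
    by (rule square_linear_root)
  have "(z + s *\<^sub>R e) \<bullet> (z + s *\<^sub>R e) = z \<bullet> z + r"
    unfolding s(1)[symmetric] using e(1)
    by (simp add: inner_simps inner_commute[of z e] power2_eq_square algebra_simps)
  also have "\<dots> = u * (x \<bullet> x) + v * (y \<bullet> y)"
    unfolding z_def r_def using square_norm_convex_defect[OF uv(3)] by metis
  also have "\<dots> \<le> u * a + v * a'"
    using x y uv by (intro add_mono mult_left_mono)
  finally have 1: "(z + s *\<^sub>R e) \<bullet> (z + s *\<^sub>R e) \<le> u * a + v * a'" .
  have eHz: "e \<bullet> (H *v z) = \<sigma> * (e \<bullet> z)"
    using inner_matrix_vector_symmetric[OF sym, of e z] e(2) by (simp add: inner_commute)
  \<comment> \<open>Since \<open>e\<close> is an eigenvector, the form grows by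
    \<open>\<sigma> / 2\<close> times the growth \<open>r\<close> of the squared norm; only the
    linear term \<open>s * (e \<bullet> c)\<close> remains besides.\<close>
  have "quadratic H c (z + s *\<^sub>R e) = quadratic H c z + \<sigma> / 2 * r + s * (e \<bullet> c)"
    unfolding quadratic_translate[OF sym] s(1)[symmetric] inner_add_right eHz e(2)
    using e(1) by (simp add: algebra_simps)
  also have "\<dots> \<le> quadratic H c z + u * v / 2 * ((x - y) \<bullet> (H *v (x - y)))"
  proof -
    \<comment> \<open>Leastness of \<open>\<sigma>\<close> enters here: the growth is at most the
      convexity defect of the form in the direction \<open>x - y\<close>.\<close>
    have "u * v / 2 * (\<sigma> * ((x - y) \<bullet> (x - y))) \<le> u * v / 2 * ((x - y) \<bullet> (H *v (x - y)))"
      using uv by (intro mult_left_mono \<sigma>) simp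
    then show ?thesis
      using s(2) unfolding r_def by (simp add: mult_ac)
  qed
  also have "\<dots> = u * quadratic H c x + v * quadratic H c y"
    unfolding z_def using quadratic_convex_defect[OF sym uv(3)] by metis
  also have "\<dots> \<le> u * b + v * b'"
    using x y uv by (intro add_mono mult_left_mono)
  finally have 2: "quadratic H c (z + s *\<^sub>R e) \<le> u * b + v * b'" .
  show "u *\<^sub>R p + v *\<^sub>R p' \<in> dominated_pairs H c"
    using 1 2 unfolding p dominated_pairs_def by auto
qed

section \<open>The convexified problem and the optimality conditions\<close>

text \<open>The common shape of the objective and all constraints in the variables (a, b, y):
  \<open>l\<close> is a coordinate or zero, and \<open>d\<close> takes up the optimal value.\<close>

lemma convex_on_linear_plus:
  fixes l :: "'a::real_vector \<Rightarrow> real" and h :: "'b::real_vector \<Rightarrow> real"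
  assumes S: "convex S" and l: "linear l" and h: "convex_on UNIV h"
  shows "convex_on (S \<times> UNIV) (\<lambda>(p, y). l p + h y + d)"
proof (rule convex_onI)
  show "convex (S \<times> (UNIV :: 'b set))"
    using S by (intro convex_Times) auto
next
  fix t :: real and P Q :: "'a \<times> 'b"
  assume t: "0 < t" "t < 1"
  obtain p y q z where PQ: "P = (p, y)" "Q = (q, z)"
    by (metis prod.exhaust)
  have "h ((1 - t) *\<^sub>R y + t *\<^sub>R z) \<le> (1 - t) * h y + t * h z"
    using h t unfolding convex_on_def by simp
  moreover have "l ((1 - t) *\<^sub>R p + t *\<^sub>R q) = (1 - t) * l p + t * l q"
    by (simp add: linear_add[OF l] linear_scale[OF l])
  ultimately show "(case (1 - t) *\<^sub>R P + t *\<^sub>R Q of (p, y) \<Rightarrow> l p + h y + d) \<le>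
      (1 - t) * (case P of (p, y) \<Rightarrow> l p + h y + d) + t * (case Q of (p, y) \<Rightarrow> l p + h y + d)"
    unfolding PQ scaleR_Pair add_Pair prod.case by argo
qed

text \<open>As \<open>gradient\<close> is a definite description, a representing vector has to be
  exhibited first: the Riesz representative of the derivative, \<open>adjoint f' 1\<close>.\<close>

lemma has_gradient:
  fixes f :: "real ^ 'm \<Rightarrow> real"
  assumes "twice_continuously_differentiable f"
  shows "(f has_derivative (\<lambda>h. h \<bullet> gradient f x)) (at x)"
proof -
  obtain f' where f': "(f has_derivative f') (at x)"
    using assms unfolding twice_continuously_differentiable_def differentiable_def by blast
  have "f' h = h \<bullet> adjoint f' 1" for h
    using adjoint_works[OF has_derivative_linear[OF f'], of h 1]
    by (simp add: inner_commute)
  then have "GDERIV f x :> adjoint f' 1"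
    unfolding gderiv_def using f' by (metis ext)
  then show ?thesis
    using gradient_eq unfolding gderiv_def by metis
qed

theorem theorem1:
  fixes H :: "real ^ 'n ^ 'n" and c :: "real ^ 'n"
    and k :: nat and f :: "nat \<Rightarrow> real ^ 'm \<Rightarrow> real"
    and xs :: "real ^ 'n" and ys :: "real ^ 'm"
  assumes "transpose H = H"
    and "\<not> pos_semidef H"
    and "k \<ge> 1"
    and "\<And>j. j \<le> k \<Longrightarrow> convex_on UNIV (f j)"
    and "\<And>j. j \<le> k \<Longrightarrow> twice_continuously_differentiable (f j)"
    and "is_arg_min (objective H c f) (feasible k f) (xs, ys)"
    and "\<exists>y. \<forall>j\<in>{1..k}. f j y < 0"
  shows "\<exists>\<mu> :: nat \<Rightarrow> real.
      (\<forall>j\<in>{1..k}. \<mu> j \<ge> 0) \<and>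
      (H + \<mu> 1 *\<^sub>R mat 1) *v xs + c = 0 \<and>
      gradient (f 0) ys + (\<mu> 1 / 2) *\<^sub>R gradient (f 1) ys
        + (\<Sum>j=2..k. \<mu> j *\<^sub>R gradient (f j) ys) = 0 \<and>
      xs \<bullet> xs + f 1 ys = 0 \<and>
      (\<forall>j\<in>{2..k}. \<mu> j * f j ys = 0) \<and>
      pos_semidef (H + \<mu> 1 *\<^sub>R mat 1)"
proof -
  define C where "C = dominated_pairs H c \<times> (UNIV :: (real ^ 'm) set)"
  define opt where "opt = objective H c f (xs, ys)"
  \<comment> \<open>Subtracting \<open>opt\<close> turns optimality into nonnegativity. The summands
    \<open>- opt\<close> here and \<open>0\<close> in \<open>g\<close> match the shape of
    \<open>convex_on_linear_plus\<close>.\<close>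
  define F where "F = (\<lambda>(p :: real \<times> real, y). snd p + f 0 y + (- opt))"
  define g where "g = (\<lambda>j (p :: real \<times> real, y). (if j = 1 then fst p else 0) + f j y + 0)"
  have obj: "objective H c f (x, y) = quadratic H c x + f 0 y" for x y
    by (simp add: objective_def quadratic_def)
  have feas: "feasible k f (xs, ys)"
    and opt: "\<And>x y. feasible k f (x, y) \<Longrightarrow> opt \<le> objective H c f (x, y)"
    using assms(6) unfolding is_arg_min_def opt_def by (auto simp: not_less)
  obtain y0 where y0: "\<forall>j\<in>{1..k}. f j y0 < 0"
    using assms(7) by blast
  have "\<exists>\<nu>. (\<forall>j\<in>{1..k}. 0 \<le> \<nu> j) \<and> (\<forall>x\<in>C. 0 \<le> F x + (\<Sum>j\<in>{1..k}. \<nu> j * g j x))"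
  proof (rule convex_lagrange_multipliers)
    have D: "convex (dominated_pairs H c)"
      by (rule convex_dominated_pairs[OF assms(1)])
    show "convex_on C F"
      unfolding C_def F_def using assms(4)
      by (intro convex_on_linear_plus D) (auto simp: linear_snd)
    show "convex_on C (g j)" if "j \<in> {1..k}" for j
    proof -
      have "linear (\<lambda>p :: real \<times> real. if j = 1 then fst p else 0)"
        by (cases "j = 1") (auto simp: linear_fst linear_zero)
      then show ?thesis
        unfolding C_def g_def using assms(4) that by (intro convex_on_linear_plus D) auto
    qed
    \<comment> \<open>The choice \<open>x = 0\<close> gives a = 0, so the strict inequalities at
      \<open>y0\<close> carry over to the first constraint too.\<close>
    have "(0, 0) \<in> dominated_pairs H c"
      unfolding dominated_pairs_def quadratic_def by (auto intro!: exI[of _ 0])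
    then show "((0, 0), y0) \<in> C"
      unfolding C_def by simp
    show "g j ((0, 0), y0) < 0" if "j \<in> {1..k}" for j
      using y0 that unfolding g_def by simp
    show "0 \<le> F P" if P: "P \<in> C" and le: "\<forall>j\<in>{1..k}. g j P \<le> 0" for P
    proof -
      obtain a b y where Peq: "P = ((a, b), y)"
        by (metis prod.exhaust)
      \<comment> \<open>The dominated \<open>x\<close> is feasible together with \<open>y\<close>
        and costs no more than the pair, so the relaxation does not lower the optimal value.\<close>
      obtain x where x: "x \<bullet> x \<le> a" "quadratic H c x \<le> b"
        using P unfolding Peq C_def dominated_pairs_def by auto
      have "a + f 1 y \<le> 0"
        using bspec[OF le, of 1] assms(3) unfolding Peq g_def by simp
      moreover have "f j y \<le> 0" if "j \<in> {2..k}" for j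
        using bspec[OF le, of j] that unfolding Peq g_def by simp
      ultimately have "feasible k f (x, y)"
        unfolding feasible_def using x(1) by auto
      from opt[OF this] show ?thesis
        using x(2) unfolding obj Peq F_def by simp
    qed
  qed simp
  then obtain \<nu> where \<nu>: "\<And>j. j \<in> {1..k} \<Longrightarrow> 0 \<le> \<nu> j"
    and L: "\<And>P. P \<in> C \<Longrightarrow> 0 \<le> F P + (\<Sum>j\<in>{1..k}. \<nu> j * g j P)"
    by blast
  have split: "{1..k} = insert 1 {2..k}"
    using assms(3) by auto
  have \<nu>1: "0 \<le> \<nu> 1"
    using \<nu> assms(3) by simp
  have lagrangian: "opt \<le> quadratic H c x + f 0 y + \<nu> 1 * (x \<bullet> x + f 1 y) + (\<Sum>j=2..k. \<nu> j * f j y)"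
    for x y
  proof -
    have "((x \<bullet> x, quadratic H c x), y) \<in> C"
      unfolding C_def dominated_pairs_def by auto
    from L[OF this] show ?thesis
      unfolding split by (simp add: F_def g_def)
  qed
  have g1: "xs \<bullet> xs + f 1 ys \<le> 0" and gj: "\<And>j. j \<in> {2..k} \<Longrightarrow> f j ys \<le> 0"
    using feas unfolding feasible_def by auto
  have t1: "\<nu> 1 * (xs \<bullet> xs + f 1 ys) \<le> 0"
    using \<nu>1 g1 by (rule mult_nonneg_nonpos)
  have tj: "\<nu> j * f j ys \<le> 0" if "j \<in> {2..k}" for j
    using \<nu> gj that by (intro mult_nonneg_nonpos) auto
  have sum_le: "(\<Sum>j=2..k. \<nu> j * f j ys) \<le> 0"
    using tj by (rule sum_nonpos)
  \<comment> \<open>The Lagrangian bound at the minimizer itself; as every product is nonpositive,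
    all of them vanish.\<close>
  have sum_ge: "0 \<le> \<nu> 1 * (xs \<bullet> xs + f 1 ys) + (\<Sum>j=2..k. \<nu> j * f j ys)"
    using lagrangian[of xs ys] unfolding opt_def obj by simp
  have c1: "\<nu> 1 * (xs \<bullet> xs + f 1 ys) = 0" and sum0: "(\<Sum>j=2..k. \<nu> j * f j ys) = 0"
    using t1 sum_le sum_ge by linarith+
  have cj: "\<forall>j\<in>{2..k}. \<nu> j * f j ys = 0"
  proof -
    have "(\<Sum>j=2..k. - (\<nu> j * f j ys)) = 0"
      using sum0 by (simp add: sum_negf)
    then show ?thesis
      using tj by (subst (asm) sum_nonneg_eq_0_iff) auto
  qed
  \<comment> \<open>With \<open>y\<close> frozen at \<open>ys\<close>, the term
    \<open>\<nu> 1 * (x \<bullet> x)\<close> is a matrix shift by \<open>2 * \<nu> 1\<close>, owing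
    to the factor 1/2 in \<open>quadratic\<close>.\<close>
  have stat_x: "quadratic (H + (2 * \<nu> 1) *\<^sub>R mat 1) c xs \<le> quadratic (H + (2 * \<nu> 1) *\<^sub>R mat 1) c x" for x
    using lagrangian[of x ys] c1 sum0 unfolding opt_def obj quadratic_shift by (simp add: algebra_simps)
  note kkt_x = quadratic_minimizer[OF transpose_shift[OF assms(1)] stat_x]
  have "2 * \<nu> 1 \<noteq> 0"
    using kkt_x(2) assms(2) by auto
  then have active: "xs \<bullet> xs + f 1 ys = 0"
    using c1 by simp
  define G where "G = gradient (f 0) ys + \<nu> 1 *\<^sub>R gradient (f 1) ys
    + (\<Sum>j=2..k. \<nu> j *\<^sub>R gradient (f j) ys)"
  \<comment> \<open>The part of the Lagrangian depending on \<open>y\<close>; with \<open>x\<close>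
    frozen at \<open>xs\<close> it is minimal at \<open>ys\<close>.\<close>
  define M where "M = (\<lambda>y. f 0 y + \<nu> 1 * f 1 y + (\<Sum>j=2..k. \<nu> j * f j y))"
  have grad: "(f j has_derivative (\<lambda>h. h \<bullet> gradient (f j) ys)) (at ys)" if "j \<le> k" for j
    using assms(5) that by (intro has_gradient)
  have "(M has_derivative (\<lambda>h. h \<bullet> gradient (f 0) ys + \<nu> 1 * (h \<bullet> gradient (f 1) ys)
      + (\<Sum>j=2..k. \<nu> j * (h \<bullet> gradient (f j) ys)))) (at ys)"
    unfolding M_def using assms(3)
    by (intro has_derivative_add has_derivative_sum has_derivative_mult_right grad) auto
  also have "(\<lambda>h. h \<bullet> gradient (f 0) ys + \<nu> 1 * (h \<bullet> gradient (f 1) ys)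
      + (\<Sum>j=2..k. \<nu> j * (h \<bullet> gradient (f j) ys))) = (\<lambda>h. h \<bullet> G)"
    unfolding G_def by (simp add: inner_add_right inner_sum_right)
  finally have M': "(M has_derivative (\<lambda>h. h \<bullet> G)) (at ys)" .
  have "M ys \<le> M y" for y
    using lagrangian[of xs y] c1 sum0 unfolding opt_def obj M_def by (simp add: algebra_simps)
  then have "(\<lambda>h. h \<bullet> G) = (\<lambda>h. 0)"
    using differential_zero_maxmin[OF _ _ M', of UNIV] by auto
  \<comment> \<open>The zero functional is evaluated at \<open>h = G\<close>.\<close>
  then have "G \<bullet> G = 0"
    by (rule fun_cong)
  then have G0: "G = 0"
    by simp
  \<comment> \<open>Only the first multiplier is doubled, which explains the factor
    \<open>\<mu> 1 / 2\<close> in the gradient equation.\<close>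
  define \<mu> where "\<mu> = \<nu>(1 := 2 * \<nu> 1)"
  have "(\<Sum>j=2..k. \<mu> j *\<^sub>R gradient (f j) ys) = (\<Sum>j=2..k. \<nu> j *\<^sub>R gradient (f j) ys)"
    unfolding \<mu>_def by (intro sum.cong) auto
  then have "gradient (f 0) ys + (\<mu> 1 / 2) *\<^sub>R gradient (f 1) ys
      + (\<Sum>j=2..k. \<mu> j *\<^sub>R gradient (f j) ys) = 0"
    using G0 unfolding G_def by (simp add: \<mu>_def)
  moreover have "\<forall>j\<in>{1..k}. 0 \<le> \<mu> j" "\<forall>j\<in>{2..k}. \<mu> j * f j ys = 0"
    using \<nu> \<nu>1 cj unfolding \<mu>_def by auto
  ultimately show ?thesis
    using kkt_x active by (intro exI[of _ \<mu>]) (auto simp: \<mu>_def)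
qed

end
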